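(* Let $n\ge1$, let $A=(a_1,\ldots,a_n)$ be a strictly decreasing sequence of real numbers and $B=(b_1,\ldots,b_n)$ a strictly increasing sequence of positive integers such that $a_i>b_{n+1-i}-1$ for all $i$ and $a_i\neq b_j-1$ for all $i,j$. Define $M=\mathbf{F}(A,B)=(f_{ij})_{i,j=1}^n$ by $f_{ij}=\frac{1}{(a_i)_{b_j}}$ if $a_i>b_j-1$ and $f_{ij}=0$ if $a_i<b_j-1$. Then $M$ is nonsingular. Furthermore, $\det(M)>0$ if $\omega(M)$ is even and $\det(M)<0$ if $\omega(M)$ is odd, where $\omega(M)$ is the number of zero entries of $M$.
   Context: $(a)_k=a(a-1)\cdots(a-k+1)$ denotes the falling factorial. A matrix of the form $\mathbf{F}(A,B)$ is called a factorial Cauchy matrix. *)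

theory Defs
  imports Complex_Main "Jordan_Normal_Form.Determinant"
begin

definition falling_factorial :: "real \<Rightarrow> nat \<Rightarrow> real" where
  "falling_factorial a k = (\<Prod>i<k. a - real i)"

(* The sequences a, b are indexed from 1 to n, whereas the rows and columns of
   a matrix of type 'a mat are indexed from 0 to n - 1; hence the shift by Suc.
   The formula leaves the entry undefined if a_i = b_j - 1; here it is then 0. *)
definition factorial_Cauchy_mat ::
  "nat \<Rightarrow> (nat \<Rightarrow> real) \<Rightarrow> (nat \<Rightarrow> nat) \<Rightarrow> real mat" where
  "factorial_Cauchy_mat n a b = mat n n (\<lambda>(i, j).
     if a (Suc i) > real (b (Suc j)) - 1
     then 1 / falling_factorial (a (Suc i)) (b (Suc j)) else 0)"

definition num_zero_entries :: "'a :: zero mat \<Rightarrow> nat" where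
  "num_zero_entries M =
     card {(i, j). i < dim_row M \<and> j < dim_col M \<and> M $$ (i, j) = 0}"

end

theory Submission
  imports Defs "Jordan_Normal_Form.Char_Poly"
begin

text \<open>
  If no entry vanishes, the matrix consists of columns of the family
  \<open>r k x = 1 / ((x - 0) (x - 1) ... (x - (k - 1)))\<close>. All minors of this family are positive, by
  induction on their size: normalise the first selected column to 1 and subtract the first row from
  the others. The divided differences that remain satisfy
  \<open>d (k + 1) = (r (k + 1) + d k) / (x - k)\<close>, where \<open>x\<close> belongs to the first row,
  and adding to a column a nonnegative multiple of the preceding one preserves positivity of all minors.

  If the last entry vanishes, the Desnanot--Jacobi identity (Dodgson condensation) expresses
  \<open>det M\<close> times the determinant of the interior by the four minors of size \<open>n - 1\<close>.
  The zeros form a staircase below the antidiagonal, so three of these minors and the interior satisfy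
  the hypotheses again, while the minor without first row and first column satisfies them or has a
  zero block that forces it to vanish. The sign \<open>(-1) ^ \<omega>\<close>, counted over the submatrices, gives
  both terms of the identity the same sign.
\<close>

section \<open>Determinants: column linearity, row scaling and elimination with a column of
  ones\<close>

lemma mat_delete_mat:
  "i \<le> n \<Longrightarrow> j \<le> n \<Longrightarrow> mat_delete (mat (Suc n) (Suc n) f) i j =
     mat n n (\<lambda>(i', j'). f (if i' < i then i' else Suc i', if j' < j then j' else Suc j'))"
  unfolding mat_delete_def by (intro eq_matI) auto

text \<open>Expand along column \<open>k\<close>: the cofactors \<open>B\<close> of that column are
  independent of its entries.\<close>

lemma det_col_linear:
  fixes f g :: "nat \<Rightarrow> 'a :: comm_ring_1"
  assumes "k < n"
  shows "det (mat n n (\<lambda>(i, j). if j = k then a * f i + b * g i else A i j)) =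
    a * det (mat n n (\<lambda>(i, j). if j = k then f i else A i j)) +
    b * det (mat n n (\<lambda>(i, j). if j = k then g i else A i j))"
proof -
  obtain n' where n: "n = Suc n'" using assms by (cases n) auto
  define B where "B i = det (mat n' n' (\<lambda>(i', j'). A (if i' < i then i' else Suc i') (if j' < k then j' else Suc j')))" for i
  have "det (mat n n (\<lambda>(i, j). if j = k then h i else A i j)) = (\<Sum>i<n. h i * ((-1) ^ (i + k) * B i))"
    for h :: "nat \<Rightarrow> 'a"
  proof -
    have "cofactor (mat n n (\<lambda>(i, j). if j = k then h i else A i j)) i k = (-1) ^ (i + k) * B i" if "i < n" for i
      using that assms unfolding cofactor_def n B_def
      by (subst mat_delete_mat) (auto intro!: arg_cong[where f = "\<lambda>x. _ * det x"] eq_matI)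
    then show ?thesis
      using assms by (subst laplace_expansion_column[where n = n and j = k]) (auto intro!: sum.cong)
  qed
  then show ?thesis
    by (simp only:) (simp add: sum_distrib_left sum.distrib[symmetric] algebra_simps)
qed

lemma det_row_scale:
  fixes A :: "nat \<Rightarrow> nat \<Rightarrow> 'a :: comm_ring_1"
  shows "det (mat n n (\<lambda>(i, j). c i * A i j)) = (\<Prod>i<n. c i) * det (mat n n (\<lambda>(i, j). A i j))"
proof -
  have *: "(\<Prod>i = 0..<n. mat n n (\<lambda>(i, j). c i * A i j) $$ (i, p i)) =
      (\<Prod>i<n. c i) * (\<Prod>i = 0..<n. mat n n (\<lambda>(i, j). A i j) $$ (i, p i))"
    if "p permutes {0..<n}" for p
  proof -
    have "p i < n" if "i < n" for i
      using permutes_in_image[OF \<open>p permutes {0..<n}\<close>, of i] that by simp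
    then show ?thesis
      by (simp add: atLeast0LessThan prod.distrib)
  qed
  show ?thesis
    by (subst (1 2) det_def'[where n = n]) (auto simp: sum_distrib_left mult.left_commute * simp del: index_mat intro!: sum.cong)
qed

text \<open>Subtracting the first row from the others turns the first column into (1, 0, ..., 0).
  The matrix \<open>L\<close> undoing this subtraction is unit lower triangular, so the determinant
  does not change.\<close>

lemma det_first_col_one:
  fixes A :: "nat \<Rightarrow> nat \<Rightarrow> 'a :: comm_ring_1"
  assumes "\<And>i. i \<le> n \<Longrightarrow> A i 0 = 1"
  shows "det (mat (Suc n) (Suc n) (\<lambda>(i, j). A i j)) =
    det (mat n n (\<lambda>(i, j). A (Suc i) (Suc j) - A 0 (Suc j)))"
proof -
  define L :: "'a mat" where "L = mat (Suc n) (Suc n) (\<lambda>(i, j). if i = j \<or> j = 0 then 1 else 0)"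
  define B where "B = mat (Suc n) (Suc n) (\<lambda>(i, j). if i = 0 then A i j else A i j - A 0 j)"
  have "mat (Suc n) (Suc n) (\<lambda>(i, j). A i j) = L * B"
  proof (rule eq_matI)
    fix i j assume ij: "i < dim_row (L * B)" "j < dim_col (L * B)"
    then have ij: "i < Suc n" "j < Suc n" by (auto simp: L_def B_def)
    have "(L * B) $$ (i, j) = (\<Sum>k = 0..<Suc n. L $$ (i, k) * B $$ (k, j))"
      using ij by (auto simp: scalar_prod_def L_def B_def)
    also have "\<dots> = (\<Sum>k = 0..<Suc n. (if k = 0 then A 0 j else 0) + (if k = i \<and> i \<noteq> 0 then A i j - A 0 j else 0))"
      using ij by (intro sum.cong) (auto simp: L_def B_def)
    also have "\<dots> = A i j"
      using ij by (cases "i = 0") (simp_all add: sum.distrib sum.delta)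
    finally show "mat (Suc n) (Suc n) (\<lambda>(i, j). A i j) $$ (i, j) = (L * B) $$ (i, j)" using ij by simp
  qed (auto simp: L_def B_def)
  then have "det (mat (Suc n) (Suc n) (\<lambda>(i, j). A i j)) = det L * det B"
    by (simp add: det_mult[where n = "Suc n"] L_def B_def)
  also have "det L = 1"
  proof -
    have "det L = prod_list (diag_mat L)"
      by (rule det_lower_triangular[where n = "Suc n"]) (auto simp: L_def)
    also have "\<dots> = (\<Prod>i\<leftarrow>[0..<Suc n]. 1)"
      unfolding diag_mat_def by (intro arg_cong[where f = prod_list] map_cong) (auto simp: L_def)
    finally show ?thesis by (simp add: map_replicate_const)
  qed
  also have "det B = (\<Sum>i<Suc n. B $$ (i, 0) * cofactor B i 0)"
    by (rule laplace_expansion_column) (auto simp: B_def)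
  also have "\<dots> = (\<Sum>i<Suc n. if i = 0 then cofactor B 0 0 else 0)"
    using assms by (intro sum.cong) (auto simp: B_def)
  also have "\<dots> = det (mat n n (\<lambda>(i, j). A (Suc i) (Suc j) - A 0 (Suc j)))"
    by (simp add: cofactor_def B_def mat_delete_mat del: sum.lessThan_Suc) 
  finally show ?thesis by simp
qed

section \<open>Column families with positive maximal minors\<close>

text \<open>The family has \<open>n\<close> rows and infinitely many columns. The column index comes
  first, so that \<open>u k\<close> is a whole column and a function update replaces it.\<close>

definition minors_pos :: "nat \<Rightarrow> (nat \<Rightarrow> nat \<Rightarrow> 'a :: linordered_idom) \<Rightarrow> bool" where
  "minors_pos n u \<longleftrightarrow>
     (\<forall>m. strict_mono_on {..<n} m \<longrightarrow> 0 < det (mat n n (\<lambda>(i, j). u (m j) i)))"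

lemma minors_pos_Suc:
  assumes "minors_pos n u" shows "minors_pos n (\<lambda>k. u (Suc k))"
  unfolding minors_pos_def
proof (intro allI impI)
  fix m :: "nat \<Rightarrow> nat" assume "strict_mono_on {..<n} m"
  then have "strict_mono_on {..<n} (\<lambda>j. Suc (m j :: nat))" by (simp add: strict_mono_on_def)
  then show "0 < det (mat n n (\<lambda>(i, j). u (Suc (m j)) i))"
    using assms unfolding minors_pos_def by blast
qed

lemma minors_pos_scale:
  assumes u: "minors_pos n u" and "c > 0"
  shows "minors_pos n (u(r := (\<lambda>i. c * u r i)))"
  unfolding minors_pos_def
proof (intro allI impI)
  fix m :: "nat \<Rightarrow> nat" assume m: "strict_mono_on {..<n} m"
  have inj: "m j = m k \<longleftrightarrow> j = k" if "j < n" "k < n" for j k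
    using m that by (metis lessThan_iff linorder_neqE_nat less_irrefl strict_mono_onD)
  have pos: "0 < det (mat n n (\<lambda>(i, j). u (m j) i))" using u m by (auto simp: minors_pos_def)
  show "0 < det (mat n n (\<lambda>(i, j). (u(r := (\<lambda>i. c * u r i))) (m j) i))"
  proof (cases "\<exists>k<n. m k = r")
    case True
    then obtain k where k: "k < n" "m k = r" by auto
    have "mat n n (\<lambda>(i, j). (u(r := (\<lambda>i. c * u r i))) (m j) i) =
        mat n n (\<lambda>(i, j). if j = k then c * u r i + 0 * u r i else u (m j) i)"
      using k inj by (intro eq_matI) auto
    moreover have "mat n n (\<lambda>(i, j). if j = k then u r i else u (m j) i) = mat n n (\<lambda>(i, j). u (m j) i)"
      using k by (intro eq_matI) auto
    ultimately show ?thesis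
      using pos \<open>c > 0\<close> by (simp only: det_col_linear[OF k(1)]) simp
  next
    case False
    then have "mat n n (\<lambda>(i, j). (u(r := (\<lambda>i. c * u r i))) (m j) i) = mat n n (\<lambda>(i, j). u (m j) i)"
      by (intro eq_matI) auto
    then show ?thesis using pos by simp
  qed
qed

(* When column Suc r is selected, the correction term is a minor with column r in its place:
   it vanishes if r is selected as well, and otherwise its columns are still in increasing order. *)
lemma minors_pos_add_prev:
  assumes u: "minors_pos n u" and "c \<ge> 0"
  shows "minors_pos n (u(Suc r := (\<lambda>i. u (Suc r) i + c * u r i)))"
  unfolding minors_pos_def
proof (intro allI impI)
  fix m :: "nat \<Rightarrow> nat" assume m: "strict_mono_on {..<n} m"
  let ?v = "u(Suc r := (\<lambda>i. u (Suc r) i + c * u r i))"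
  have inj: "m j = m k \<longleftrightarrow> j = k" if "j < n" "k < n" for j k
    using m that by (metis lessThan_iff linorder_neqE_nat less_irrefl strict_mono_onD)
  have pos: "0 < det (mat n n (\<lambda>(i, j). u (m j) i))" using u m by (auto simp: minors_pos_def)
  show "0 < det (mat n n (\<lambda>(i, j). ?v (m j) i))"
  proof (cases "\<exists>k<n. m k = Suc r")
    case True
    then obtain k where k: "k < n" "m k = Suc r" by auto
    let ?B = "mat n n (\<lambda>(i, j). if j = k then u r i else u (m j) i)"
    have B: "0 \<le> det ?B"
    proof (cases "\<exists>l<n. m l = r")
      case True
      then obtain l where l: "l < n" "m l = r" by auto
      then have "l \<noteq> k" using k by auto
      have "det ?B = 0"
        by (rule det_identical_columns[of _ n l k]) (use k l \<open>l \<noteq> k\<close> in auto)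
      then show ?thesis by simp
    next
      case False
      have "strict_mono_on {..<n} (m(k := r))"
      proof (rule strict_mono_onI)
        fix i j assume ij: "i \<in> {..<n}" "j \<in> {..<n}" "i < j"
        then have "m i < m j" using strict_mono_onD[OF m] by blast
        moreover have "m i \<noteq> r" using ij False by auto
        ultimately show "(m(k := r)) i < (m(k := r)) j" using k ij by auto
      qed
      then have "0 < det (mat n n (\<lambda>(i, j). u ((m(k := r)) j) i))"
        using u by (simp only: minors_pos_def)
      also have "mat n n (\<lambda>(i, j). u ((m(k := r)) j) i) = ?B" by (intro eq_matI) auto
      finally show ?thesis by simp
    qed
    have ne: "m j \<noteq> Suc r" if "j < n" "j \<noteq> k" for j
      using inj[OF that(1) k(1)] that k by simp
    have "mat n n (\<lambda>(i, j). ?v (m j) i) =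
        mat n n (\<lambda>(i, j). if j = k then 1 * u (Suc r) i + c * u r i else u (m j) i)"
      using k ne by (intro eq_matI) auto
    moreover have "mat n n (\<lambda>(i, j). if j = k then u (Suc r) i else u (m j) i) = mat n n (\<lambda>(i, j). u (m j) i)"
      using k by (intro eq_matI) auto
    ultimately show ?thesis
      using pos B \<open>c \<ge> 0\<close> by (simp only: det_col_linear[OF k(1)]) (simp add: add_pos_nonneg)
  next
    case False
    then have "mat n n (\<lambda>(i, j). ?v (m j) i) = mat n n (\<lambda>(i, j). u (m j) i)"
      by (intro eq_matI) auto
    then show ?thesis using pos by simp
  qed
qed

text \<open>Convert the columns from left to right: at stage \<open>r\<close> the preceding column
  is already \<open>h (r - 1)\<close>, so column \<open>r\<close> becomes \<open>h r\<close> by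
  adding it and scaling by \<open>p r\<close>. A single minor involves finitely many columns, so
  some finite stage already agrees with \<open>h\<close> on them.\<close>

lemma minors_pos_recurrence:
  fixes u h :: "nat \<Rightarrow> nat \<Rightarrow> 'a :: linordered_idom"
  assumes u: "minors_pos n u"
    and h0: "h 0 = (\<lambda>i. p 0 * u 0 i)"
    and hS: "\<And>k. h (Suc k) = (\<lambda>i. p (Suc k) * (u (Suc k) i + h k i))"
    and p: "\<And>k. p k > 0"
  shows "minors_pos n h"
proof -
  have stage: "minors_pos n (\<lambda>k. if k < r then h k else u k)" for r
  proof (induction r)
    case 0
    show ?case using u by simp
  next
    case (Suc r)
    let ?w = "\<lambda>k. if k < r then h k else u k"
    show ?case
    proof (cases r)
      case 0
      have "(\<lambda>k. if k < Suc r then h k else u k) = u(0 := (\<lambda>i. p 0 * u 0 i))"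
        using 0 h0 by auto
      then show ?thesis using minors_pos_scale[OF u p, of 0 0] by simp
    next
      case (Suc s)
      let ?w' = "?w(Suc s := (\<lambda>i. ?w (Suc s) i + 1 * ?w s i))"
      have "(\<lambda>k. if k < Suc r then h k else u k) = ?w'(r := (\<lambda>i. p r * ?w' r i))"
        using Suc hS by (auto simp: fun_eq_iff)
      moreover have "minors_pos n ?w'" by (rule minors_pos_add_prev[OF Suc.IH]) simp
      then have "minors_pos n (?w'(r := (\<lambda>i. p r * ?w' r i)))" using p by (rule minors_pos_scale)
      ultimately show ?thesis by (simp only:)
    qed
  qed
  show ?thesis
    unfolding minors_pos_def
  proof (intro allI impI)
    fix m :: "nat \<Rightarrow> nat" assume m: "strict_mono_on {..<n} m"
    \<comment> \<open>A stage beyond every selected column; the sum serves as a bound for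
      \<open>n = 0\<close> too.\<close>
    define r where "r = Suc (\<Sum>j<n. m j)"
    have "m j < r" if "j < n" for j
      using member_le_sum[of j "{..<n}" m] that by (simp add: r_def)
    then have "mat n n (\<lambda>(i, j). h (m j) i) = mat n n (\<lambda>(i, j). (if m j < r then h (m j) else u (m j)) i)"
      by (intro eq_matI) auto
    moreover have "0 < det (mat n n (\<lambda>(i, j). (if m j < r then h (m j) else u (m j)) i))"
      using stage[of r] m unfolding minors_pos_def by blast
    ultimately show "0 < det (mat n n (\<lambda>(i, j). h (m j) i))" by simp
  qed
qed

text \<open>Arbitrary nodes \<open>lam\<close> make the induction go through: dividing each row by
  its entry in the first selected column \<open>m 0\<close> leaves products over the nodes from
  \<open>lam (m 0)\<close> onwards.\<close>

lemma reciprocal_Newton_minors_pos: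
  fixes x lam :: "nat \<Rightarrow> 'a :: linordered_field"
  assumes "\<And>i j. i < j \<Longrightarrow> j < n \<Longrightarrow> x j < x i"
    and "\<And>i l. i < n \<Longrightarrow> lam l < x i"
  shows "minors_pos n (\<lambda>k i. \<Prod>l<k. 1 / (x i - lam l))"
  using assms
proof (induction n arbitrary: x lam)
  case 0
  show ?case by (simp add: minors_pos_def)
next
  case (Suc n)
  show ?case
    unfolding minors_pos_def
  proof (intro allI impI)
    fix m :: "nat \<Rightarrow> nat" assume m: "strict_mono_on {..<Suc n} m"
    define nu where "nu l = lam (m 0 + l)" for l
    define r where "r k y = (\<Prod>l<k. 1 / (y - nu l))" for k and y :: 'a
    \<comment> \<open>The negated divided difference of \<open>r k\<close> at \<open>x 0\<close> and
      \<open>x (Suc i)\<close>. With this sign the denominator and the coefficients of the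
      recurrence \<open>rec\<close> are positive.\<close>
    define d where "d k i = (r k (x (Suc i)) - r k (x 0)) / (x 0 - x (Suc i))" for k i
    have m0: "m 0 < m (Suc j)" if "j < n" for j
      using strict_mono_onD[OF m, of 0 "Suc j"] that by simp
    have "minors_pos n (\<lambda>k i. r k (x (Suc i)))"
      unfolding r_def using Suc.prems by (intro Suc.IH) (auto simp: nu_def)
    then have u: "minors_pos n (\<lambda>k i. r (Suc k) (x (Suc i)))" by (rule minors_pos_Suc)
    have pos: "0 < x i - nu l" if "i < Suc n" for i l
      using Suc.prems(2)[OF that, of "m 0 + l"] by (simp add: nu_def)
    have lt: "x (Suc i) < x 0" if "i < n" for i
      using Suc.prems(1)[of 0 "Suc i"] that by simp
    have rec: "d (Suc k) i = 1 / (x 0 - nu k) * (r (Suc k) (x (Suc i)) + d k i)" if "i < n" for k i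
    proof -
      define s t X Y where "s = r k (x 0)" and "t = r k (x (Suc i))"
        and "X = x 0 - nu k" and "Y = x (Suc i) - nu k"
      have "X > 0" "Y > 0" "X - Y > 0"
        using pos[of 0 k] pos[of "Suc i" k] lt[OF that] that by (auto simp: X_def Y_def)
      then have "(t / Y - s / X) / (X - Y) = 1 / X * (t / Y + (t - s) / (X - Y))"
        by (simp add: field_simps)
      then show ?thesis by (simp add: d_def r_def s_def t_def X_def Y_def)
    qed
    \<comment> \<open>\<open>h k\<close> is \<open>d (Suc k)\<close> on the rows below
      \<open>n\<close>; the index is shifted because \<open>d 0\<close> vanishes.
      \<open>minors_pos_recurrence\<close> asks for equality of columns as functions, at every
      \<open>i\<close>, whereas \<open>rec\<close> covers only \<open>i < n\<close>; hence the
      definition by recursion.\<close>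
    define h where "h = rec_nat (\<lambda>i. 1 / (x 0 - nu 0) * r (Suc 0) (x (Suc i)))
        (\<lambda>k f i. 1 / (x 0 - nu (Suc k)) * (r (Suc (Suc k)) (x (Suc i)) + f i))"
    have h: "h k i = d (Suc k) i" if "i < n" for k i
    proof (induction k)
      case 0
      show ?case using rec[OF that, of 0] by (simp add: h_def d_def r_def)
    next
      case (Suc k)
      then show ?case using rec[OF that, of "Suc k"] by (simp add: h_def)
    qed
    have "minors_pos n h"
      by (rule minors_pos_recurrence[OF u, where p = "\<lambda>k. 1 / (x 0 - nu k)"]) (use pos[of 0] in \<open>auto simp: h_def\<close>)
    moreover have "strict_mono_on {..<n} (\<lambda>j. m (Suc j) - Suc (m 0))"
    proof (rule strict_mono_onI)
      fix i j assume "i \<in> {..<n}" "j \<in> {..<n}" "i < j"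
      then show "m (Suc i) - Suc (m 0) < m (Suc j) - Suc (m 0)"
        using m0[of i] m0[of j] strict_mono_onD[OF m, of "Suc i" "Suc j"] by simp
    qed
    ultimately have "0 < det (mat n n (\<lambda>(i, j). h (m (Suc j) - Suc (m 0)) i))"
      unfolding minors_pos_def by blast
    \<comment> \<open>The reduction is now undone: the row factors \<open>x 0 - x (Suc i)\<close>
      turn divided differences into differences, the first row and the column of ones return, and
      finally each row regains its factor over the first \<open>m 0\<close> nodes.\<close>
    then have "0 < (\<Prod>i<n. x 0 - x (Suc i)) * \<dots>"
      using lt by (intro mult_pos_pos prod_pos) auto
    also have "\<dots> = det (mat n n (\<lambda>(i, j). (x 0 - x (Suc i)) * h (m (Suc j) - Suc (m 0)) i))"
      by (rule det_row_scale[symmetric])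
    also have "mat n n (\<lambda>(i, j). (x 0 - x (Suc i)) * h (m (Suc j) - Suc (m 0)) i) =
        mat n n (\<lambda>(i, j). r (m (Suc j) - m 0) (x (Suc i)) - r (m (Suc j) - m 0) (x 0))"
    proof (rule eq_matI, goal_cases)
      case (1 i j)
      then have "i < n" "j < n" by auto
      moreover from this have "Suc (m (Suc j) - Suc (m 0)) = m (Suc j) - m 0" using m0[of j] by simp
      ultimately show ?case using lt[of i] by (simp add: h d_def)
    qed auto
    also have "det \<dots> = det (mat (Suc n) (Suc n) (\<lambda>(i, j). r (m j - m 0) (x i)))"
      by (rule det_first_col_one[symmetric]) (simp add: r_def)
    finally have "0 < (\<Prod>i<Suc n. \<Prod>l<m 0. 1 / (x i - lam l)) * \<dots>"
      using Suc.prems(2) by (intro mult_pos_pos prod_pos) auto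
    also have "\<dots> = det (mat (Suc n) (Suc n) (\<lambda>(i, j). (\<Prod>l<m 0. 1 / (x i - lam l)) * r (m j - m 0) (x i)))"
      by (rule det_row_scale[symmetric])
    also have "mat (Suc n) (Suc n) (\<lambda>(i, j). (\<Prod>l<m 0. 1 / (x i - lam l)) * r (m j - m 0) (x i)) =
        mat (Suc n) (Suc n) (\<lambda>(i, j). \<Prod>l<m j. 1 / (x i - lam l))"
    proof (rule eq_matI, goal_cases)
      case (1 i j)
      have split: "(\<Prod>l<a + b. f l) = (\<Prod>l<a. f l) * (\<Prod>l<b. f (a + l))" for a b and f :: "nat \<Rightarrow> 'a"
        by (induction b) (simp_all add: mult.assoc)
      from 1 have "m 0 \<le> m j" using m0[of "j - 1"] by (cases j) auto
      then show ?case
        using 1 split[of "\<lambda>l. 1 / (x i - lam l)" "m 0" "m j - m 0"] by (simp add: r_def nu_def)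
    qed auto
    finally show "0 < det (mat (Suc n) (Suc n) (\<lambda>(i, j). \<Prod>l<m j. 1 / (x i - lam l)))" .
  qed
qed

section \<open>Dodgson condensation and determinants with a zero block\<close>

lemma det_row_single:
  fixes A :: "'a :: comm_ring_1 mat"
  assumes "A \<in> carrier_mat n n" "i < n" "j < n" "\<And>k. k < n \<Longrightarrow> k \<noteq> j \<Longrightarrow> A $$ (i, k) = 0"
  shows "det A = A $$ (i, j) * cofactor A i j"
proof -
  have "det A = (\<Sum>k<n. A $$ (i, k) * cofactor A i k)"
    using assms by (intro laplace_expansion_row)
  also have "\<dots> = (\<Sum>k\<in>{j}. A $$ (i, k) * cofactor A i k)"
    using assms by (intro sum.mono_neutral_right) auto
  finally show ?thesis by simp
qed

lemma det_col_single:
  fixes A :: "'a :: comm_ring_1 mat"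
  assumes "A \<in> carrier_mat n n" "i < n" "j < n" "\<And>k. k < n \<Longrightarrow> k \<noteq> i \<Longrightarrow> A $$ (k, j) = 0"
  shows "det A = A $$ (i, j) * cofactor A i j"
proof -
  have "det A = (\<Sum>k<n. A $$ (k, j) * cofactor A k j)"
    using assms by (intro laplace_expansion_column)
  also have "\<dots> = (\<Sum>k\<in>{i}. A $$ (k, j) * cofactor A k j)"
    using assms by (intro sum.mono_neutral_right) auto
  finally show ?thesis by simp
qed

text \<open>Needed for the matrix \<open>B\<close> of the condensation identity. The first row is
  nonzero at most in the two outer columns, and in both remaining minors the last row has at most
  one nonzero entry.\<close>

lemma det_replace_outer_cols_one:
  fixes u v :: "nat \<Rightarrow> 'a :: comm_ring_1"
  shows "det (mat (Suc (Suc n)) (Suc (Suc n))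
      (\<lambda>(i, j). if j = 0 then u i else if j = Suc n then v i else if i = j then 1 else 0)) =
    u 0 * v (Suc n) - v 0 * u (Suc n)" (is "det ?B = _")
proof -
  have one: "mat n n (\<lambda>(i, j). if i = j then 1 else 0) = (1\<^sub>m n :: 'a mat)"
    by (intro eq_matI) auto
  have del0: "mat_delete ?B 0 0 =
      mat (Suc n) (Suc n) (\<lambda>(i, j). if j = n then v (Suc i) else if i = j then 1 else 0)" (is "_ = ?C")
    by (subst mat_delete_mat) (auto intro!: eq_matI)
  have C: "det ?C = v (Suc n)"
  proof -
    have "mat_delete ?C n n = 1\<^sub>m n"
      by (subst mat_delete_mat) (auto intro!: eq_matI)
    then show ?thesis
      by (subst det_row_single[where n = "Suc n" and i = n and j = n]) (auto simp: cofactor_def)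
  qed
  have deln: "mat_delete ?B 0 (Suc n) =
      mat (Suc n) (Suc n) (\<lambda>(i, j). if j = 0 then u (Suc i) else if Suc i = j then 1 else 0)" (is "_ = ?D")
    by (subst mat_delete_mat) (auto intro!: eq_matI)
  have D: "det ?D = (-1) ^ n * u (Suc n)"
  proof -
    have "mat_delete ?D n 0 = 1\<^sub>m n"
      by (subst mat_delete_mat) (auto intro!: eq_matI)
    then show ?thesis
      by (subst det_row_single[where n = "Suc n" and i = n and j = 0]) (auto simp: cofactor_def)
  qed
  have "det ?B = (\<Sum>j<Suc (Suc n). ?B $$ (0, j) * cofactor ?B 0 j)"
    by (rule laplace_expansion_row) auto
  also have "\<dots> = (\<Sum>j\<in>{0, Suc n}. ?B $$ (0, j) * cofactor ?B 0 j)"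
    by (rule sum.mono_neutral_right) auto
  also have "\<dots> = u 0 * det ?C + v 0 * ((-1) ^ Suc n * det ?D)"
    by (simp add: cofactor_def del0 deln)
  also have "\<dots> = u 0 * v (Suc n) - v 0 * u (Suc n)"
    by (simp add: C D flip: power_add mult.assoc)
  finally show ?thesis .
qed

text \<open>Jacobi's argument: replace the outer columns of the identity by those of the adjugate of
  \<open>M\<close>. Multiplying by \<open>M\<close> gives \<open>C\<close>, which is
  \<open>M\<close> with its outer columns replaced by \<open>det M\<close> times unit vectors.
  Taking determinants and cancelling one factor \<open>det M\<close> gives the identity.\<close>

lemma Desnanot_Jacobi_nonsingular:
  fixes A :: "nat \<Rightarrow> nat \<Rightarrow> 'a :: idom"
  assumes nz: "det (mat (Suc (Suc n)) (Suc (Suc n)) (\<lambda>(i, j). A i j)) \<noteq> 0"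
  shows "det (mat (Suc (Suc n)) (Suc (Suc n)) (\<lambda>(i, j). A i j)) *
      det (mat n n (\<lambda>(i, j). A (Suc i) (Suc j))) =
    det (mat (Suc n) (Suc n) (\<lambda>(i, j). A (Suc i) (Suc j))) *
      det (mat (Suc n) (Suc n) (\<lambda>(i, j). A i j)) -
    det (mat (Suc n) (Suc n) (\<lambda>(i, j). A (Suc i) j)) *
      det (mat (Suc n) (Suc n) (\<lambda>(i, j). A i (Suc j)))"
proof -
  let ?N = "Suc (Suc n)"
  define M where "M = mat ?N ?N (\<lambda>(i, j). A i j)"
  have M: "M \<in> carrier_mat ?N ?N" by (simp add: M_def)
  define B where "B = mat ?N ?N (\<lambda>(i, j).
    if j = 0 then cofactor M 0 i else if j = Suc n then cofactor M (Suc n) i else if i = j then 1 else 0)"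
  define C where "C = mat ?N ?N (\<lambda>(i, j). if j = 0 then (if i = 0 then det M else 0)
    else if j = Suc n then (if i = Suc n then det M else 0) else A i j)"
  have B: "B \<in> carrier_mat ?N ?N" by (simp add: B_def)
  have MB: "M * B = C"
  proof (rule eq_matI)
    fix i j assume "i < dim_row C" "j < dim_col C"
    then have ij: "i < ?N" "j < ?N" by (auto simp: C_def)
    show "(M * B) $$ (i, j) = C $$ (i, j)"
    proof (cases "j = 0 \<or> j = Suc n")
      case True
      then have "col B j = col (adj_mat M) j"
        by (intro eq_vecI) (auto simp: B_def adj_mat_def M_def)
      then have "(M * B) $$ (i, j) = (M * adj_mat M) $$ (i, j)"
        using ij M B adj_mat(1)[OF M] by simp
      then show ?thesis using True ij by (auto simp: adj_mat(2)[OF M] C_def)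
    next
      case False
      then have "(M * B) $$ (i, j) = (\<Sum>k = 0..<?N. if k = j then A i k else 0)"
        using ij unfolding times_mat_def scalar_prod_def
        by (auto simp: M_def B_def if_distrib[where f = "\<lambda>x. _ * x"] simp del: sum.op_ivl_Suc cong: if_cong)
      then show ?thesis using False ij by (simp add: C_def sum.delta del: sum.op_ivl_Suc)
    qed
  qed (auto simp: M_def B_def C_def)
  define C' where "C' = mat (Suc n) (Suc n) (\<lambda>(i, j).
    if j = n then (if i = n then det M else 0) else A (Suc i) (Suc j))"
  have "mat_delete C 0 0 = C'" unfolding C_def C'_def
    by (subst mat_delete_mat) (auto intro!: eq_matI)
  then have "det C = det M * det C'"
    by (subst det_col_single[where n = ?N and i = 0 and j = 0]) (auto simp: C_def cofactor_def)
  moreover have "mat_delete C' n n = mat n n (\<lambda>(i, j). A (Suc i) (Suc j))" unfolding C'_def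
    by (subst mat_delete_mat) (auto intro!: eq_matI)
  then have "det C' = det M * det (mat n n (\<lambda>(i, j). A (Suc i) (Suc j)))"
    by (subst det_col_single[where n = "Suc n" and i = n and j = n]) (auto simp: C'_def cofactor_def)
  moreover have "det C = det M * det B"
    using det_mult[OF M B] MB by simp
  ultimately have *: "det M * det (mat n n (\<lambda>(i, j). A (Suc i) (Suc j))) = det B"
    using nz by (simp add: M_def)
  have "det B = cofactor M 0 0 * cofactor M (Suc n) (Suc n) - cofactor M (Suc n) 0 * cofactor M 0 (Suc n)"
    unfolding B_def by (rule det_replace_outer_cols_one)
  moreover have "mat_delete M 0 0 = mat (Suc n) (Suc n) (\<lambda>(i, j). A (Suc i) (Suc j))"
    "mat_delete M (Suc n) (Suc n) = mat (Suc n) (Suc n) (\<lambda>(i, j). A i j)"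
    "mat_delete M (Suc n) 0 = mat (Suc n) (Suc n) (\<lambda>(i, j). A i (Suc j))"
    "mat_delete M 0 (Suc n) = mat (Suc n) (Suc n) (\<lambda>(i, j). A (Suc i) j)"
    unfolding M_def by (subst mat_delete_mat; auto intro!: eq_matI)+
  moreover have "(-1) ^ n * ((-1) ^ n * x) = x" for x :: 'a
    by (simp flip: mult.assoc power_add mult_2)
  ultimately show ?thesis
    using * by (simp add: cofactor_def mult_ac flip: M_def)
qed

(* Adding an indeterminate to the diagonal makes the determinant a monic polynomial,
   which removes the nonsingularity assumption. *)
lemma Desnanot_Jacobi:
  fixes A :: "nat \<Rightarrow> nat \<Rightarrow> 'a :: idom"
  shows "det (mat (Suc (Suc n)) (Suc (Suc n)) (\<lambda>(i, j). A i j)) *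
      det (mat n n (\<lambda>(i, j). A (Suc i) (Suc j))) =
    det (mat (Suc n) (Suc n) (\<lambda>(i, j). A (Suc i) (Suc j))) *
      det (mat (Suc n) (Suc n) (\<lambda>(i, j). A i j)) -
    det (mat (Suc n) (Suc n) (\<lambda>(i, j). A (Suc i) j)) *
      det (mat (Suc n) (Suc n) (\<lambda>(i, j). A i (Suc j)))"
proof -
  let ?N = "Suc (Suc n)"
  define P where "P i j = (if i = j then [:A i j, 1:] else [:A i j:])" for i j
  \<comment> \<open>The characteristic matrix of the negated matrix is the matrix plus the
    indeterminate times the identity.\<close>
  have "char_poly_matrix (mat ?N ?N (\<lambda>(i, j). - A i j)) = mat ?N ?N (\<lambda>(i, j). P i j)"
    unfolding char_poly_matrix_def P_def by (intro eq_matI) auto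
  moreover have "char_poly (mat ?N ?N (\<lambda>(i, j). - A i j)) \<noteq> 0"
    using degree_monic_char_poly[of "mat ?N ?N (\<lambda>(i, j). - A i j)" ?N] by auto
  ultimately have "det (mat ?N ?N (\<lambda>(i, j). P i j)) \<noteq> 0"
    by (simp add: char_poly_def)
  note id = Desnanot_Jacobi_nonsingular[OF this]
  have hom: "comm_ring_hom (\<lambda>p :: 'a poly. poly p 0)"
    by unfold_locales auto
  have eval: "poly (det (mat k k (\<lambda>(i, j). P (f i) (g j)))) 0 = det (mat k k (\<lambda>(i, j). A (f i) (g j)))" for k f g
    unfolding comm_ring_hom.hom_det[OF hom, symmetric] by (intro arg_cong[where f = det] eq_matI) (auto simp: P_def)
  show ?thesis
    using arg_cong[OF id, of "\<lambda>p. poly p 0"]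
      eval[of _ "\<lambda>i. i" "\<lambda>j. j"] eval[of _ Suc Suc] eval[of _ Suc "\<lambda>j. j"] eval[of _ "\<lambda>i. i" Suc]
    by simp
qed

text \<open>Every term of the Leibniz formula meets the block: a permutation cannot send the
  \<open>n - r\<close> rows from \<open>r\<close> on into only \<open>c < n - r\<close>
  columns.\<close>

lemma det_zero_block:
  fixes A :: "'a :: comm_ring_1 mat"
  assumes A: "A \<in> carrier_mat n n" and "r + c < n"
    and zero: "\<And>i j. r \<le> i \<Longrightarrow> i < n \<Longrightarrow> c \<le> j \<Longrightarrow> j < n \<Longrightarrow> A $$ (i, j) = 0"
  shows "det A = 0"
proof -
  have "(\<Prod>i = 0..<n. A $$ (i, p i)) = 0" if p: "p permutes {0..<n}" for p
  proof -
    have "\<not> p ` {r..<n} \<subseteq> {..<c}"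
    proof
      assume "p ` {r..<n} \<subseteq> {..<c}"
      then have "card (p ` {r..<n}) \<le> c" using card_mono[of "{..<c}"] by simp
      moreover have "card (p ` {r..<n}) = n - r"
        using permutes_inj_on[OF p] by (simp add: card_image)
      ultimately show False using \<open>r + c < n\<close> by simp
    qed
    then obtain i where "r \<le> i" "i < n" "c \<le> p i" by (auto simp: image_subset_iff not_less)
    moreover from this have "p i < n" using permutes_in_image[OF p, of i] by simp
    ultimately show ?thesis using zero by (intro prod_zero bexI[of _ i]) auto
  qed
  then show ?thesis by (simp add: det_def'[OF A])
qed

section \<open>The sign of the determinant of a factorial Cauchy matrix\<close>

definition factorial_Cauchy_entry :: "real \<Rightarrow> nat \<Rightarrow> real" where
  "factorial_Cauchy_entry x k = (if x > real k - 1 then 1 / falling_factorial x k else 0)"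

text \<open>Minus one marks a zero entry. Products of these signs encode the parity of the number of
  zeros and factor over interior, sides and corners.\<close>

definition entry_sign :: "real \<Rightarrow> nat \<Rightarrow> real" where
  "entry_sign x k = (if x > real k - 1 then 1 else - 1)"

lemma factorial_Cauchy_entry_eq_0_iff:
  "factorial_Cauchy_entry x k = 0 \<longleftrightarrow> \<not> x > real k - 1"
  by (auto simp: factorial_Cauchy_entry_def falling_factorial_def)

text \<open>The last row has the least \<open>a\<close> and the last column the greatest
  \<open>b\<close>, so \<open>last\<close> makes every entry nonzero. The matrix then consists of
  the columns \<open>b j\<close> of a reciprocal Newton family.\<close>

lemma det_factorial_Cauchy_pos:
  assumes a: "\<And>i j. i < j \<Longrightarrow> j < Suc n \<Longrightarrow> a j < a i"
    and b: "strict_mono_on {..<Suc n} b"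
    and last: "a n > real (b n) - 1"
  shows "0 < det (mat (Suc n) (Suc n) (\<lambda>(i, j). factorial_Cauchy_entry (a i) (b j)))"
proof -
  \<comment> \<open>The nodes 0, 1, 2, ... are capped below all \<open>a i\<close>; only those below \<open>b n\<close> matter.\<close>
  define lam where "lam l = min (real l) (real (b n) - 1)" for l
  have a_n: "a n \<le> a i" if "i < Suc n" for i
    using a[of i n] that by (cases "i = n") auto
  have b_n: "b j \<le> b n" if "j < Suc n" for j
    using strict_mono_onD[OF b, of j n] that by (cases "j = n") auto
  have "minors_pos (Suc n) (\<lambda>k i. \<Prod>l<k. 1 / (a i - lam l))"
    using a a_n last by (intro reciprocal_Newton_minors_pos) (fastforce simp: lam_def)+
  then have "0 < det (mat (Suc n) (Suc n) (\<lambda>(i, j). \<Prod>l<b j. 1 / (a i - lam l)))"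
    using b by (auto simp: minors_pos_def)
  also have "mat (Suc n) (Suc n) (\<lambda>(i, j). \<Prod>l<b j. 1 / (a i - lam l)) =
      mat (Suc n) (Suc n) (\<lambda>(i, j). factorial_Cauchy_entry (a i) (b j))"
  proof (rule eq_matI, goal_cases)
    case (1 i j)
    then have ij: "i < Suc n" "j < Suc n" by auto
    have "real (b j) - 1 < a i" using a_n[OF ij(1)] b_n[OF ij(2)] last by linarith
    moreover have "lam l = real l" if "l < b j" for l
      using that b_n[OF ij(2)] by (simp add: lam_def)
    ultimately show ?case
      using ij by (simp add: factorial_Cauchy_entry_def falling_factorial_def prod_dividef)
  qed auto
  finally show ?thesis .
qed

text \<open>The induction is strong because condensation refers to sizes \<open>N - 1\<close> and
  \<open>N - 2\<close>. The third assumption makes the entries on and above the antidiagonal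
  nonzero, a form that the interior and three of the four minors inherit.\<close>

lemma entry_sign_det_factorial_Cauchy_pos:
  assumes "\<And>i j. i < j \<Longrightarrow> j < n \<Longrightarrow> a j < a i"
    and "strict_mono_on {..<n} b"
    and "\<And>i j. i + j < n \<Longrightarrow> a i > real (b j) - 1"
  shows "0 < (\<Prod>i<n. \<Prod>j<n. entry_sign (a i) (b j)) *
    det (mat n n (\<lambda>(i, j). factorial_Cauchy_entry (a i) (b j)))"
  using assms
proof (induction n arbitrary: a b rule: less_induct)
  case (less N)
  note a = less.prems(1) and b = less.prems(2) and ab = less.prems(3)
  let ?s = entry_sign and ?f = factorial_Cauchy_entry
  have b_less: "b i < b j" if "i < j" "j < N" for i j
    using strict_mono_onD[OF b, of i j] that by simp
  have b_Suc: "strict_mono_on {..<k} (\<lambda>j. b (Suc j))" if "k < N" for k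
    using that b_less by (intro strict_mono_onI) auto
  have b_sub: "strict_mono_on {..<k} b" if "k < N" for k
    using that b_less by (intro strict_mono_onI) auto
  \<comment> \<open>A vanishing last entry forces size at least 2, since the entry at (0, 0) is
    nonzero.\<close>
  consider "N = 0" | n where "N = Suc n" "a n > real (b n) - 1"
    | n where "N = Suc (Suc n)" "\<not> a (Suc n) > real (b (Suc n)) - 1"
  proof -
    assume that: "N = 0 \<Longrightarrow> thesis" "\<And>n. N = Suc n \<Longrightarrow> a n > real (b n) - 1 \<Longrightarrow> thesis"
      "\<And>n. N = Suc (Suc n) \<Longrightarrow> \<not> a (Suc n) > real (b (Suc n)) - 1 \<Longrightarrow> thesis"
    show thesis
    proof (cases N)
      case (Suc k)
      then show ?thesis using that ab[of 0 0] by (cases k) auto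
    qed (use that in simp)
  qed
  then show ?case
  proof cases
    case 1
    then show ?thesis by simp
  next
    case (2 n)
    have "?s (a i) (b j) = 1" if "i < N" "j < N" for i j
    proof -
      have "a n \<le> a i" using a[of i n] that 2 by (cases "i = n") auto
      moreover have "b j \<le> b n" using b_less[of j n] that 2 by (cases "j = n") auto
      ultimately show ?thesis using 2 by (simp add: entry_sign_def)
    qed
    then have "(\<Prod>i<N. \<Prod>j<N. ?s (a i) (b j)) = 1" by simp
    moreover have "0 < det (mat N N (\<lambda>(i, j). ?f (a i) (b j)))"
      unfolding 2(1) using a b 2 by (intro det_factorial_Cauchy_pos) auto
    ultimately show ?thesis by simp
  next
    case (3 n)
    \<comment> \<open>Sign products over the interior and over the four sides without their
      corners.\<close>
    define I where "I = (\<Prod>i<n. \<Prod>j<n. ?s (a (Suc i)) (b (Suc j)))"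
    define top where "top = (\<Prod>j<n. ?s (a 0) (b (Suc j)))"
    define bot where "bot = (\<Prod>j<n. ?s (a (Suc n)) (b (Suc j)))"
    define lft where "lft = (\<Prod>i<n. ?s (a (Suc i)) (b 0))"
    define rgt where "rgt = (\<Prod>i<n. ?s (a (Suc i)) (b (Suc n)))"
    note sides = I_def top_def bot_def lft_def rgt_def
    have corners: "?s (a 0) (b 0) = 1" "?s (a 0) (b (Suc n)) = 1" "?s (a (Suc n)) (b 0) = 1"
      "?s (a (Suc n)) (b (Suc n)) = - 1"
      using ab[of 0 0] ab[of 0 "Suc n"] ab[of "Suc n" 0] 3 by (auto simp: entry_sign_def)
    have sd: "(\<Prod>i<N. \<Prod>j<N. ?s (a i) (b j)) = - (top * lft * I * rgt * bot)"
    proof -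
      have "(\<Prod>j<N. g j) = g 0 * (\<Prod>j<n. g (Suc j)) * g (Suc n)" for g :: "nat \<Rightarrow> real"
        unfolding 3(1) by (subst prod.lessThan_Suc, subst prod.lessThan_Suc_shift) simp
      then show ?thesis by (simp add: prod.distrib corners sides)
    qed
    have sz: "(\<Prod>i<Suc n. \<Prod>j<Suc n. ?s (a (Suc i)) (b j)) = lft * I * bot"
      by (subst prod.lessThan_Suc, subst (1 2) prod.lessThan_Suc_shift)
        (simp add: prod.distrib corners sides)
    have sw: "(\<Prod>i<Suc n. \<Prod>j<Suc n. ?s (a i) (b (Suc j))) = top * I * rgt"
      by (subst prod.lessThan_Suc_shift, subst (1 2) prod.lessThan_Suc)
        (simp add: prod.distrib corners sides)
    have sy: "(\<Prod>i<Suc n. \<Prod>j<Suc n. ?s (a i) (b j)) = top * lft * I"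
      by (subst prod.lessThan_Suc_shift, subst (1 2) prod.lessThan_Suc_shift)
        (simp add: prod.distrib corners sides)
    have sx: "(\<Prod>i<Suc n. \<Prod>j<Suc n. ?s (a (Suc i)) (b (Suc j))) = - (I * rgt * bot)"
      by (simp add: prod.distrib corners sides)
    define d where "d = det (mat N N (\<lambda>(i, j). ?f (a i) (b j)))"
    define e where "e = det (mat n n (\<lambda>(i, j). ?f (a (Suc i)) (b (Suc j))))"
    define x where "x = det (mat (Suc n) (Suc n) (\<lambda>(i, j). ?f (a (Suc i)) (b (Suc j))))"
    define y where "y = det (mat (Suc n) (Suc n) (\<lambda>(i, j). ?f (a i) (b j)))"
    define z where "z = det (mat (Suc n) (Suc n) (\<lambda>(i, j). ?f (a (Suc i)) (b j)))"
    define w where "w = det (mat (Suc n) (Suc n) (\<lambda>(i, j). ?f (a i) (b (Suc j))))"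
    have id: "d * e = x * y - z * w"
      unfolding d_def e_def x_def y_def z_def w_def 3(1) by (rule Desnanot_Jacobi)
    have e: "0 < I * e"
      unfolding e_def I_def using a ab b_Suc 3(1) by (intro less.IH) auto
    have y: "0 < top * lft * I * y"
      unfolding y_def sy[symmetric] using a ab b_sub 3(1) by (intro less.IH) auto
    have z: "0 < lft * I * bot * z"
      unfolding z_def sz[symmetric] using a ab b_sub 3(1) by (intro less.IH) auto
    have w: "0 < top * I * rgt * w"
      unfolding w_def sw[symmetric] using a ab b_Suc 3(1) by (intro less.IH) auto
    \<comment> \<open>Deleting the first row and column moves the antidiagonal of the minor one step
      beyond that of the full matrix. If the condition fails at \<open>(r, c)\<close>, monotonicity
      of \<open>a\<close> and \<open>b\<close> makes everything to the lower right vanish, and this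
      block is large enough for \<open>det_zero_block\<close>.\<close>
    have x: "0 \<le> - (I * rgt * bot) * x"
    proof (cases "\<forall>i j. i + j < Suc n \<longrightarrow> a (Suc i) > real (b (Suc j)) - 1")
      case True
      then have "0 < - (I * rgt * bot) * x"
        unfolding x_def sx[symmetric] using a b_Suc 3(1) by (intro less.IH) auto
      then show ?thesis by simp
    next
      case False
      then obtain r c where rc: "r + c < Suc n" "a (Suc r) \<le> real (b (Suc c)) - 1" by force
      have "?f (a (Suc i)) (b (Suc j)) = 0" if "r \<le> i" "i < Suc n" "c \<le> j" "j < Suc n" for i j
      proof -
        have "a (Suc i) \<le> a (Suc r)" using a[of "Suc r" "Suc i"] that 3(1) by (cases "i = r") auto
        moreover have "b (Suc c) \<le> b (Suc j)"
          using b_less[of "Suc c" "Suc j"] that 3(1) by (cases "j = c") auto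
        ultimately show ?thesis using rc by (simp add: factorial_Cauchy_entry_def)
      qed
      then have "x = 0"
        unfolding x_def using rc by (intro det_zero_block[of _ "Suc n" r c]) auto
      then show ?thesis by simp
    qed
    \<comment> \<open>Both summands carry the same sign product up to a minus, which matches the
      minus in \<open>x * y - z * w\<close>. The positive factor \<open>I * e\<close> is then
      cancelled.\<close>
    have "0 < (- (I * rgt * bot) * x) * (top * lft * I * y) + (lft * I * bot * z) * (top * I * rgt * w)"
      by (rule add_nonneg_pos[OF mult_nonneg_nonneg[OF x less_imp_le[OF y]] mult_pos_pos[OF z w]])
    also have "\<dots> = (- (top * lft * I * rgt * bot) * I) * (x * y - z * w)"
      by (simp add: algebra_simps)
    also have "\<dots> = (- (top * lft * I * rgt * bot) * d) * (I * e)"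
      unfolding id[symmetric] by (simp add: mult_ac)
    finally have "0 < - (top * lft * I * rgt * bot) * d"
      using e by (metis zero_less_mult_pos2)
    then show ?thesis unfolding sd d_def .
  qed
qed

lemma prod_entry_sign:
  "(\<Prod>i<n. \<Prod>j<n. entry_sign (a i) (b j)) =
    (-1) ^ num_zero_entries (mat n n (\<lambda>(i, j). factorial_Cauchy_entry (a i) (b j)))"
proof -
  have "(\<Prod>i<n. \<Prod>j<n. entry_sign (a i) (b j)) =
      (\<Prod>p\<in>{..<n} \<times> {..<n}. if factorial_Cauchy_entry (a (fst p)) (b (snd p)) = 0 then - 1 else 1)"
    unfolding prod.cartesian_product
    by (intro prod.cong) (auto simp: entry_sign_def factorial_Cauchy_entry_eq_0_iff)
  also have "\<dots> = (-1) ^ card ({..<n} \<times> {..<n} \<inter> {p. factorial_Cauchy_entry (a (fst p)) (b (snd p)) = 0})"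
    by (simp add: prod.If_cases)
  also have "{..<n} \<times> {..<n} \<inter> {p. factorial_Cauchy_entry (a (fst p)) (b (snd p)) = 0} =
      {(i, j). i < n \<and> j < n \<and> mat n n (\<lambda>(i, j). factorial_Cauchy_entry (a i) (b j)) $$ (i, j) = 0}"
    by auto
  finally show ?thesis by (simp add: num_zero_entries_def)
qed

theorem theorem4p3:
  fixes n :: nat and a :: "nat \<Rightarrow> real" and b :: "nat \<Rightarrow> nat" and M :: "real mat"
  assumes "n \<ge> 1"
    and "strict_antimono_on {1..n} a"
    and "strict_mono_on {1..n} b"
    and "\<And>j. j \<in> {1..n} \<Longrightarrow> b j > 0"
    and "\<And>i. i \<in> {1..n} \<Longrightarrow> a i > real (b (n + 1 - i)) - 1"
    and "\<And>i j. i \<in> {1..n} \<Longrightarrow> j \<in> {1..n} \<Longrightarrow> a i \<noteq> real (b j) - 1"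
    and "M = factorial_Cauchy_mat n a b"
  shows "invertible_mat M
    \<and> (even (num_zero_entries M) \<longrightarrow> det M > 0)
    \<and> (odd (num_zero_entries M) \<longrightarrow> det M < 0)"
proof -
  have M: "M = mat n n (\<lambda>(i, j). factorial_Cauchy_entry (a (Suc i)) (b (Suc j)))"
    unfolding assms(7) factorial_Cauchy_mat_def factorial_Cauchy_entry_def by simp
  have "0 < (\<Prod>i<n. \<Prod>j<n. entry_sign (a (Suc i)) (b (Suc j))) * det M"
    unfolding M
  proof (rule entry_sign_det_factorial_Cauchy_pos)
    show "a (Suc j) < a (Suc i)" if "i < j" "j < n" for i j
      using monotone_onD[OF assms(2), of "Suc i" "Suc j"] that by simp
    show "strict_mono_on {..<n} (\<lambda>j. b (Suc j))"
      using strict_mono_onD[OF assms(3)] by (intro strict_mono_onI) simp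
    show "a (Suc i) > real (b (Suc j)) - 1" if "i + j < n" for i j
    proof -
      \<comment> \<open>The hypothesis for row \<open>Suc i\<close> concerns column
        \<open>n - i\<close>, on the antidiagonal; since \<open>b\<close> increases, it extends to
        all columns further left.\<close>
      have "b (Suc j) \<le> b (n - i)"
      proof (cases "Suc j = n - i")
        case False
        with that have "Suc j < n - i" by simp
        then show ?thesis using strict_mono_onD[OF assms(3), of "Suc j" "n - i"] that by simp
      qed simp
      then show ?thesis using assms(5)[of "Suc i"] that by simp
    qed
  qed
  then have sign: "0 < (-1) ^ num_zero_entries M * det M"
    by (simp only: prod_entry_sign M)
  have carrier: "M \<in> carrier_mat n n" by (simp add: M)
  from sign have "det M \<noteq> 0" by auto
  then have "inverts_mat M ((1 / det M) \<cdot>\<^sub>m adj_mat M)" "inverts_mat ((1 / det M) \<cdot>\<^sub>m adj_mat M) M"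
    using adj_mat[OF carrier] carrier
      mult_smult_distrib[OF carrier adj_mat(1)[OF carrier]] mult_smult_assoc_mat[OF adj_mat(1)[OF carrier] carrier]
    by (auto simp: inverts_mat_def intro!: eq_matI)
  then have "invertible_mat M"
    using carrier unfolding invertible_mat_def by auto
  with sign show ?thesis by auto
qed

end
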